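(* If $T\subseteq\mathbb{Z}^n$ is an integer tiling with $\Upsilon_n$, then $n\not\equiv 4\pmod 6$.
   Context: $\Upsilon_n=\{U\in\mathbb{Z}^n:\sum_i|x_i-u_i|\le1\text{ for some }X\in\{-1,0\}^n\}$. A set $T\subseteq\mathbb{Z}^n$ is an integer tiling with $\Upsilon_n$ if the translates $X+\Upsilon_n$, $X\in T$, partition $\mathbb{Z}^n$. *)

theory Defs
  imports "HOL-Analysis.Finite_Cartesian_Product" "HOL-Library.Disjoint_Sets"
    "HOL-Number_Theory.Cong"
begin

definition Upsilon :: "(int ^ 'n) set" where
  "Upsilon = {U. \<exists>X. (\<forall>i. X $ i \<in> {-1, 0}) \<and> (\<Sum>i\<in>UNIV. \<bar>X $ i - U $ i\<bar>) \<le> 1}"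

text \<open>The translates are treated as a family indexed by \<open>T\<close>, so distinct points of \<open>T\<close>
  must give disjoint translates.\<close>

definition integer_tiling :: "(int ^ 'n) set \<Rightarrow> (int ^ 'n) set \<Rightarrow> bool" where
  "integer_tiling T S \<longleftrightarrow>
     disjoint_family_on (\<lambda>X. (+) X ` S) T \<and> (\<Union>X\<in>T. (+) X ` S) = UNIV"

end

theory Submission
  imports Defs
begin

text \<open>
  Call \<open>S\<close> the union of the cubes \<open>x + {-1, 0}\<^sup>n\<close> with \<open>x\<close> in the tiling, and \<open>f\<close> its indicator function.
  The tiling property says that the sum of \<open>f\<close> over the \<open>2n\<close> neighbours of a point \<open>u\<close> is
  \<open>1 + (n - 1) f(u)\<close>. If \<open>n \<equiv> 1\<close> modulo 3, this sum is 1 modulo 3 everywhere, and cubing the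
  neighbour-sum operator (Frobenius modulo 3) shows that the sum of \<open>f\<close> over the points
  \<open>u \<plusminus> 3 e\<^sub>j\<close> is \<open>4n\<^sup>2 \<equiv> 1\<close> modulo 3; in particular one of these points lies in \<open>S\<close>.

  Translate the tiling so that it contains 0. The points \<open>e\<^sub>i + e\<^sub>k\<close> are covered either by a triple
  tile, with entries 2 at \<open>i\<close>, \<open>k\<close> and a third coordinate, or by a tile with entries 3 and 2 at \<open>i\<close>
  and \<open>k\<close>. For fixed \<open>i\<close> the triples pair up coordinates \<open>k\<close>, so if \<open>n\<close> is even there is a tile of the
  second kind (an edge tile). Such a tile turns out to be exactly \<open>3 e\<^sub>i + 2 e\<^sub>k\<close>, and then a short case analysis shows
  that no point \<open>e\<^sub>i \<plusminus> 3 e\<^sub>j\<close> lies in \<open>S\<close>.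
\<close>

section \<open>Coordinate form of the tiling property\<close>

text \<open>Distance at most 1 from the cube \<open>x + {-1, 0}^n\<close> means leaving it in at
  most one coordinate \<open>l\<close>, by one unit on either side; hence the range from -2 to 1.
  The sum of absolute values disappears from all later arguments.\<close>

definition near :: "int ^ 'n \<Rightarrow> int ^ 'n \<Rightarrow> bool" where
  "near x u \<longleftrightarrow> (\<exists>l. (\<forall>i. i \<noteq> l \<longrightarrow> u $ i - x $ i \<in> {-1, 0}) \<and> u $ l - x $ l \<in> {-2..1})"

definition tiling :: "(int ^ 'n) set \<Rightarrow> bool" where
  "tiling T \<longleftrightarrow> (\<forall>u. \<exists>!x. x \<in> T \<and> near x u)"

definition cubes :: "(int ^ 'n) set \<Rightarrow> (int ^ 'n) set" where
  "cubes T = {u. \<exists>x\<in>T. \<forall>i. u $ i - x $ i \<in> {-1, 0}}"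

definition flip :: "('n \<Rightarrow> int) \<Rightarrow> int ^ 'n \<Rightarrow> int ^ 'n" where
  "flip s x = (\<chi> i. s i * x $ i)"

lemma Upsilon_iff_near: "U \<in> Upsilon \<longleftrightarrow> near 0 U"
proof
  assume "U \<in> Upsilon"
  then obtain X where X: "\<forall>i. X $ i \<in> {-1, 0}" "(\<Sum>i\<in>UNIV. \<bar>X $ i - U $ i\<bar>) \<le> 1"
    unfolding Upsilon_def by blast
  have "\<exists>l. \<forall>i. i \<noteq> l \<longrightarrow> X $ i = U $ i"
  proof (rule ccontr)
    assume H: "\<nexists>l. \<forall>i. i \<noteq> l \<longrightarrow> X $ i = U $ i"
    then obtain a where a: "X $ a \<noteq> U $ a" by blast
    from H obtain b where b: "b \<noteq> a" "X $ b \<noteq> U $ b" by blast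
    have "(\<Sum>i\<in>{a, b}. \<bar>X $ i - U $ i\<bar>) \<le> (\<Sum>i\<in>UNIV. \<bar>X $ i - U $ i\<bar>)"
      by (rule sum_mono2) auto
    with a b X(2) show False by auto
  qed
  then obtain l where l: "\<forall>i. i \<noteq> l \<longrightarrow> X $ i = U $ i" by blast
  have "\<bar>X $ l - U $ l\<bar> \<le> (\<Sum>i\<in>UNIV. \<bar>X $ i - U $ i\<bar>)"
    by (rule member_le_sum) auto
  with X have "\<bar>X $ l - U $ l\<bar> \<le> 1" "X $ l \<in> {-1, 0}" by auto
  then have "U $ l \<in> {-2..1}" by auto
  moreover have "\<forall>i. i \<noteq> l \<longrightarrow> U $ i \<in> {-1, 0}" using l X(1) by metis
  ultimately show "near 0 U" unfolding near_def by auto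
next
  assume "near 0 U"
  then obtain l where l: "\<And>i. i \<noteq> l \<Longrightarrow> U $ i \<in> {-1, 0}" "U $ l \<in> {-2..1}"
    unfolding near_def by auto
  \<comment> \<open>The point of the cube nearest to \<open>U\<close>, found by clamping each
    coordinate.\<close>
  define X :: "int ^ 'a" where "X = (\<chi> i. max (-1) (min 0 (U $ i)))"
  have "\<bar>X $ i - U $ i\<bar> \<le> (if i = l then 1 else 0)" for i
    using l(1)[of i] l(2) by (auto simp: X_def)
  then have "(\<Sum>i\<in>UNIV. \<bar>X $ i - U $ i\<bar>) \<le> (\<Sum>i\<in>UNIV. if i = l then 1 else 0)"
    by (rule sum_mono)
  also have "\<dots> = 1" by simp
  finally have "(\<Sum>i\<in>UNIV. \<bar>X $ i - U $ i\<bar>) \<le> 1" .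
  moreover have "\<forall>i. X $ i \<in> {-1, 0}" by (auto simp: X_def)
  ultimately show "U \<in> Upsilon" unfolding Upsilon_def by blast
qed

lemma near_translate: "near x u \<longleftrightarrow> near (x + c) (u + c)"
  unfolding near_def by simp

lemma integer_tiling_Upsilon_imp_tiling:
  fixes T :: "(int ^ 'n) set"
  assumes "integer_tiling T Upsilon"
  shows "tiling T"
  unfolding tiling_def
proof
  fix u :: "int ^ 'n"
  have mem: "u \<in> (+) x ` Upsilon \<longleftrightarrow> near x u" for x
  proof -
    have "u \<in> (+) x ` Upsilon \<longleftrightarrow> u - x \<in> Upsilon" by (force simp: image_iff)
    then show ?thesis using near_translate[of 0 "u - x" x] by (simp add: Upsilon_iff_near)
  qed
  have "u \<in> (\<Union>X\<in>T. (+) X ` Upsilon)" using assms by (auto simp: integer_tiling_def)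
  then obtain x where x: "x \<in> T" "near x u" using mem by blast
  show "\<exists>!x. x \<in> T \<and> near x u"
  proof (rule ex1I[of _ x])
    show "x \<in> T \<and> near x u" using x by simp
    fix y assume y: "y \<in> T \<and> near y u"
    show "y = x"
    proof (rule ccontr)
      assume "y \<noteq> x"
      then have "(+) y ` Upsilon \<inter> (+) x ` Upsilon = {}"
        using assms x y unfolding integer_tiling_def disjoint_family_on_def by simp
      then show False using mem[of x] mem[of y] x y by blast
    qed
  qed
qed

section \<open>Translations and reflections of a tiling\<close>

lemma tiling_translate:
  assumes "tiling T"
  shows "tiling {x. x + c \<in> T}"
  unfolding tiling_def
proof
  fix u
  have "\<exists>!x. x \<in> T \<and> near x (u + c)" using assms by (simp add: tiling_def)
  then obtain x where x: "x \<in> T" "near x (u + c)"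
    "\<And>y. y \<in> T \<Longrightarrow> near y (u + c) \<Longrightarrow> y = x" by blast
  show "\<exists>!x. x \<in> {x. x + c \<in> T} \<and> near x u"
  proof (rule ex1I[of _ "x - c"])
    show "x - c \<in> {x. x + c \<in> T} \<and> near (x - c) u"
      using x(1,2) near_translate[of "x - c" u c] by simp
    fix y assume "y \<in> {x. x + c \<in> T} \<and> near y u"
    then have "y + c = x" using x(3)[of "y + c"] near_translate[of y u c] by simp
    then show "y = x - c" by auto
  qed
qed

lemma flip_flip:
  assumes "\<And>i. s i \<in> {1, -1}"
  shows "flip s (flip s x) = x"
proof -
  have "s i * (s i * x $ i) = x $ i" for i using assms[of i] by auto
  then show ?thesis by (simp add: flip_def vec_eq_iff)
qed

lemma flip_zero [simp]: "flip s 0 = 0"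
  by (simp add: flip_def vec_eq_iff)

text \<open>Tile positions transform by \<open>x \<mapsto> -x\<close> in the flipped coordinates, but covered points by
  \<open>u \<mapsto> -1 - u\<close>, because the cube \<open>{-1, 0}\<close> is not centred at 0.\<close>

lemma tiling_flip:
  assumes "tiling T" and s: "\<And>i. s i \<in> {1, -1}"
  shows "tiling {x. flip s x \<in> T}"
  unfolding tiling_def
proof
  fix u :: "int ^ 'a"
  define u' :: "int ^ 'a" where "u' = (\<chi> i. if s i = 1 then u $ i else -1 - u $ i)"
  have nr: "near (flip s x) u' \<longleftrightarrow> near x u" for x
  proof -
    have "u' $ i - flip s x $ i \<in> {-1, 0} \<longleftrightarrow> u $ i - x $ i \<in> {-1, 0}" for i
      using s[of i] by (auto simp: u'_def flip_def)
    moreover have "u' $ i - flip s x $ i \<in> {-2..1} \<longleftrightarrow> u $ i - x $ i \<in> {-2..1}" for i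
      using s[of i] by (auto simp: u'_def flip_def)
    ultimately show ?thesis unfolding near_def by metis
  qed
  have "\<exists>!x. x \<in> T \<and> near x u'" using assms by (simp add: tiling_def)
  then obtain x where x: "x \<in> T" "near x u'"
    "\<And>y. y \<in> T \<Longrightarrow> near y u' \<Longrightarrow> y = x" by blast
  show "\<exists>!x. x \<in> {x. flip s x \<in> T} \<and> near x u"
  proof (rule ex1I[of _ "flip s x"])
    show "flip s x \<in> {x. flip s x \<in> T} \<and> near (flip s x) u"
      using x(1,2) nr[of "flip s x"] flip_flip[of s x, OF s] by simp
    fix y assume "y \<in> {x. flip s x \<in> T} \<and> near y u"
    then have "flip s y = x" using x(3)[of "flip s y"] nr by simp
    then show "y = flip s x" using flip_flip[of s y, OF s] by simp
  qed
qed

section \<open>How close two tiles can be\<close>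

lemma tiling_unique:
  "tiling T \<Longrightarrow> x \<in> T \<Longrightarrow> y \<in> T \<Longrightarrow> near x u \<Longrightarrow> near y u \<Longrightarrow> x = y"
  unfolding tiling_def by blast

text \<open>Where entries differ by at most 1, the two cubes share a value. A difference of 2 leaves
  a gap that one extra unit bridges: \<open>x\<close> spends its unit at \<open>a\<close>,
  \<open>y\<close> spends its own at \<open>b\<close>, and both cover \<open>u\<close>. With
  \<open>a = b\<close> this allows one coordinate of difference 2.\<close>

lemma tiling_eqI_two:
  assumes "tiling T" "x \<in> T" "y \<in> T"
    and "\<bar>x $ a - y $ a\<bar> \<le> 2" "\<bar>x $ b - y $ b\<bar> \<le> 2"
    and "\<And>i. i \<noteq> a \<Longrightarrow> i \<noteq> b \<Longrightarrow> \<bar>x $ i - y $ i\<bar> \<le> 1"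
  shows "x = y"
proof -
  define u :: "int ^ 'a" where
    "u = (\<chi> i. if i = b then (if x $ i > y $ i then x $ i - 1 else x $ i)
               else (if y $ i > x $ i then y $ i - 1 else y $ i))"
  have "near x u" unfolding near_def
  proof (intro exI[of _ a] conjI allI impI)
    fix i assume "i \<noteq> a"
    then show "u $ i - x $ i \<in> {-1, 0}" using assms(6)[of i] by (auto simp: u_def)
  next
    show "u $ a - x $ a \<in> {-2..1}" using assms(4) by (auto simp: u_def)
  qed
  moreover have "near y u" unfolding near_def
  proof (intro exI[of _ b] conjI allI impI)
    fix i assume "i \<noteq> b"
    then show "u $ i - y $ i \<in> {-1, 0}" by (auto simp: u_def)
  next
    show "u $ b - y $ b \<in> {-2..1}" using assms(5) by (auto simp: u_def)
  qed
  ultimately show ?thesis using tiling_unique assms(1-3) by blast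
qed

text \<open>Here both tiles spend their extra unit along the same coordinate \<open>a\<close>, where
  the two ranges of length four still meet at difference 3.\<close>

lemma tiling_eqI_one:
  assumes "tiling T" "x \<in> T" "y \<in> T"
    and "\<bar>x $ a - y $ a\<bar> \<le> 3"
    and "\<And>i. i \<noteq> a \<Longrightarrow> \<bar>x $ i - y $ i\<bar> \<le> 1"
  shows "x = y"
proof (cases "\<bar>x $ a - y $ a\<bar> \<le> 2")
  case True
  then show ?thesis using tiling_eqI_two[of T x y a a] assms by blast
next
  case False
  define u :: "int ^ 'a" where
    "u = (\<chi> i. if i = a then (if x $ i > y $ i then x $ i - 2 else x $ i + 1) else min (x $ i) (y $ i))"
  have "near x u" unfolding near_def
  proof (intro exI[of _ a] conjI allI impI)
    fix i assume "i \<noteq> a"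
    then show "u $ i - x $ i \<in> {-1, 0}" using assms(5)[of i] by (auto simp: u_def min_def)
  next
    show "u $ a - x $ a \<in> {-2..1}" using assms(4) False by (auto simp: u_def)
  qed
  moreover have "near y u" unfolding near_def
  proof (intro exI[of _ a] conjI allI impI)
    fix i assume "i \<noteq> a"
    then show "u $ i - y $ i \<in> {-1, 0}" using assms(5)[of i] by (auto simp: u_def min_def)
  next
    show "u $ a - y $ a \<in> {-2..1}" using assms(4) False by (auto simp: u_def)
  qed
  ultimately show ?thesis using tiling_unique assms(1-3) by blast
qed

section \<open>Tiles covering e_i + e_k and 2 e_j when 0 is a tile\<close>

lemma cover_two:
  assumes T: "tiling T" "0 \<in> T" and ik: "i \<noteq> k"
  obtains V where "V \<in> T" "V $ i = 3" "V $ k = 2"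
      "\<And>l. l \<noteq> i \<Longrightarrow> l \<noteq> k \<Longrightarrow> V $ l \<in> {0, 1}"
  | V where "V \<in> T" "V $ i = 2" "V $ k = 3"
      "\<And>l. l \<noteq> i \<Longrightarrow> l \<noteq> k \<Longrightarrow> V $ l \<in> {0, 1}"
  | V m where "V \<in> T" "m \<noteq> i" "m \<noteq> k"
      "V $ i = 2" "V $ k = 2" "V $ m = 2"
      "\<And>l. l \<noteq> i \<Longrightarrow> l \<noteq> k \<Longrightarrow> l \<noteq> m \<Longrightarrow> V $ l \<in> {0, 1}"
proof -
  let ?u = "axis i 1 + axis k 1 :: int ^ 'a"
  obtain V where V: "V \<in> T" "near V ?u" using T(1) unfolding tiling_def by blast
  obtain m where m: "\<And>l. l \<noteq> m \<Longrightarrow> ?u $ l - V $ l \<in> {-1, 0}" "?u $ m - V $ m \<in> {-2..1}"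
    using V(2) unfolding near_def by blast
  have out: "V $ l \<in> {0, 1}" if "l \<noteq> i" "l \<noteq> k" "l \<noteq> m" for l
    using m(1)[of l] that by (auto simp: axis_def)
  have Vi: "V $ i \<in> {0..3}" "i \<noteq> m \<Longrightarrow> V $ i \<in> {1, 2}"
    using m(1)[of i] m(2) ik by (auto simp: axis_def split: if_splits)
  have Vk: "V $ k \<in> {0..3}" "k \<noteq> m \<Longrightarrow> V $ k \<in> {1, 2}"
    using m(1)[of k] m(2) ik by (auto simp: axis_def split: if_splits)
  have Vm: "m \<noteq> i \<Longrightarrow> m \<noteq> k \<Longrightarrow> V $ m \<in> {-1..2}"
    using m(2) by (auto simp: axis_def)
  \<comment> \<open>The tile at 0 leaves its cube in one coordinate only, but the point has entry 1
    at both \<open>i\<close> and \<open>k\<close>.\<close>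
  have "V \<noteq> 0"
  proof
    assume "V = 0"
    then show False using m(1)[of i] m(1)[of k] ik by (auto simp: axis_def split: if_splits)
  qed
  \<comment> \<open>\<open>A\<close> and \<open>B\<close> are the shapes too close to 0. Each case
    below pushes the entries of \<open>V\<close> up to their largest possible values because
    anything smaller has such a shape.\<close>
  have A: "\<not> (\<bar>V $ a\<bar> \<le> 2 \<and> \<bar>V $ b\<bar> \<le> 2 \<and> (\<forall>l. l \<noteq> a \<longrightarrow> l \<noteq> b \<longrightarrow> \<bar>V $ l\<bar> \<le> 1))" for a b
    using tiling_eqI_two[OF T(1) V(1) T(2), of a b] \<open>V \<noteq> 0\<close> by auto
  have B: "\<not> (\<bar>V $ a\<bar> \<le> 3 \<and> (\<forall>l. l \<noteq> a \<longrightarrow> \<bar>V $ l\<bar> \<le> 1))" for a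
    using tiling_eqI_one[OF T(1) V(1) T(2), of a] \<open>V \<noteq> 0\<close> by auto
  have out1: "\<bar>V $ l\<bar> \<le> 1" if "l \<noteq> i" "l \<noteq> k" "l \<noteq> m" for l using out[OF that] by auto
  consider "m = i" | "m = k" | "m \<noteq> i" "m \<noteq> k" by blast
  then show thesis
  proof cases
    case 1
    have k2: "V $ k = 2"
    proof (rule ccontr)
      assume "V $ k \<noteq> 2"
      then have "V $ k = 1" using Vk 1 ik by auto
      then have "\<bar>V $ l\<bar> \<le> 1" if "l \<noteq> i" for l using out1[of l] that 1 by (cases "l = k") auto
      then show False using B[of i] Vi by auto
    qed
    have "V $ i = 3" using A[of i k] Vi(1) k2 out1 1 by force
    then show thesis using that(1) V k2 out 1 by metis
  next
    case 2
    have i2: "V $ i = 2"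
    proof (rule ccontr)
      assume "V $ i \<noteq> 2"
      then have "V $ i = 1" using Vi 2 ik by auto
      then have "\<bar>V $ l\<bar> \<le> 1" if "l \<noteq> k" for l using out1[of l] that 2 by (cases "l = i") auto
      then show False using B[of k] Vk by auto
    qed
    have "V $ k = 3" using A[of i k] Vk(1) i2 out1 2 by force
    then show thesis using that(2) V i2 out 2 by metis
  next
    case 3
    have i: "V $ i = 2"
    proof (rule ccontr)
      assume "V $ i \<noteq> 2"
      then have "V $ i = 1" using Vi 3 by auto
      then have "\<bar>V $ l\<bar> \<le> 1" if "l \<noteq> k" "l \<noteq> m" for l using out1[of l] that by (cases "l = i") auto
      then show False using A[of k m] Vk Vm 3 by auto
    qed
    have k: "V $ k = 2"
    proof (rule ccontr)
      assume "V $ k \<noteq> 2"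
      then have "V $ k = 1" using Vk 3 by auto
      then have "\<bar>V $ l\<bar> \<le> 1" if "l \<noteq> i" "l \<noteq> m" for l using out1[of l] that by (cases "l = k") auto
      then show False using A[of i m] Vi Vm 3 by auto
    qed
    have m: "V $ m = 2"
    proof (rule ccontr)
      assume "V $ m \<noteq> 2"
      then have "\<bar>V $ m\<bar> \<le> 1" using Vm 3 by auto
      then have "\<bar>V $ l\<bar> \<le> 1" if "l \<noteq> i" "l \<noteq> k" for l using out1[of l] that by (cases "l = m") auto
      then show False using A[of i k] i k by auto
    qed
    show thesis using that(3) V i k m out 3 by metis
  qed
qed

text \<open>If a further entry were 1, at \<open>k\<close> say, the tile \<open>V\<close> covering
  e_i + e_k would be close enough to \<open>Y\<close> to coincide with it. But every shape allowed
  by \<open>cover_two\<close> has entry at least 2 at \<open>k\<close>.\<close>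

lemma three_two_exact:
  assumes T: "tiling T" "0 \<in> T" and Y: "Y \<in> T" "i \<noteq> j" "Y $ i = 3" "Y $ j = 2"
    and out: "\<And>l. l \<noteq> i \<Longrightarrow> l \<noteq> j \<Longrightarrow> Y $ l \<in> {0, 1}"
  shows "Y = axis i 3 + axis j 2"
proof -
  have "Y $ k = 0" if k: "k \<noteq> i" "k \<noteq> j" for k
  proof (rule ccontr)
    assume "Y $ k \<noteq> 0"
    then have Yk: "Y $ k = 1" using out k by auto
    from k have "i \<noteq> k" by simp
    from T this show False
    proof (cases rule: cover_two)
      case (1 V)
      have "\<bar>V $ l - Y $ l\<bar> \<le> 1" if "l \<noteq> j" for l
        using 1(2,3) 1(4)[of l] out[of l] that Y Yk by (cases "l = i"; cases "l = k") auto
      then have "V = Y" using tiling_eqI_two[OF T(1) \<open>V \<in> T\<close> Y(1), of j j] 1(4)[of j] Y k by auto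
      with 1 Yk show False by auto
    next
      case (2 V)
      have "\<bar>V $ l - Y $ l\<bar> \<le> 1" if "l \<noteq> j" "l \<noteq> k" for l
        using 2(2,3) 2(4)[of l] out[of l] that Y Yk by (cases "l = i") auto
      then have "V = Y" using tiling_eqI_two[OF T(1) \<open>V \<in> T\<close> Y(1), of j k] 2(3) 2(4)[of j] Y Yk k by auto
      with 2 Yk show False by auto
    next
      case (3 V m)
      have "\<bar>V $ l - Y $ l\<bar> \<le> 1" if "l \<noteq> j" "l \<noteq> m" for l
        using 3(4,5) 3(7)[of l] out[of l] that Y Yk by (cases "l = i"; cases "l = k") auto
      moreover have "\<bar>V $ m - Y $ m\<bar> \<le> 2" using 3 out[of m] Y by (cases "m = j") auto
      moreover have "\<bar>V $ j - Y $ j\<bar> \<le> 2" using 3(7)[of j] 3(6) Y k by (cases "m = j") auto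
      ultimately have "V = Y" using tiling_eqI_two[OF T(1) \<open>V \<in> T\<close> Y(1), of j m] by auto
      with 3 Yk show False by auto
    qed
  qed
  then show ?thesis using Y by (auto simp: vec_eq_iff axis_def)
qed

text \<open>As in \<open>three_two_exact\<close>: a stray entry 1 at \<open>k\<close> is refuted by
  the tile covering e_i + e_k.\<close>

lemma four_exact:
  assumes T: "tiling T" "0 \<in> T" and Y: "Y \<in> T" "Y $ i = 4"
    and out: "\<And>l. l \<noteq> i \<Longrightarrow> Y $ l \<in> {0, 1}"
  shows "Y = axis i 4"
proof -
  have "Y $ k = 0" if k: "k \<noteq> i" for k
  proof (rule ccontr)
    assume "Y $ k \<noteq> 0"
    then have Yk: "Y $ k = 1" using out k by auto
    from k have "i \<noteq> k" by simp
    from T this show False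
    proof (cases rule: cover_two)
      case (1 V)
      have "\<bar>V $ l - Y $ l\<bar> \<le> 1" for l
        using 1(2,3) 1(4)[of l] out[of l] Y Yk by (cases "l = i"; cases "l = k") auto
      moreover from this[of i] have "\<bar>V $ i - Y $ i\<bar> \<le> 3" by simp
      ultimately have "V = Y" using tiling_eqI_one[OF T(1) \<open>V \<in> T\<close> Y(1), of i] by blast
      with 1 Yk show False by auto
    next
      case (2 V)
      have "\<bar>V $ l - Y $ l\<bar> \<le> 1" if "l \<noteq> i" "l \<noteq> k" for l
        using 2(4)[of l] out[of l] that by auto
      then have "V = Y" using tiling_eqI_two[OF T(1) \<open>V \<in> T\<close> Y(1), of i k] 2(2,3) Y Yk by auto
      with 2 Yk show False by auto
    next
      case (3 V m)
      have "\<bar>V $ l - Y $ l\<bar> \<le> 1" if "l \<noteq> i" "l \<noteq> m" for l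
        using 3(5) 3(7)[of l] out[of l] that Y Yk by (cases "l = k") auto
      then have "V = Y" using tiling_eqI_two[OF T(1) \<open>V \<in> T\<close> Y(1), of i m] 3 out[of m] Y by auto
      with 3 Yk show False by auto
    qed
  qed
  then show ?thesis using Y by (auto simp: vec_eq_iff axis_def)
qed

lemma cover_double:
  assumes T: "tiling T" "0 \<in> T"
  obtains "axis j 4 \<in> T" | l where "l \<noteq> j" "axis j 3 + axis l 2 \<in> T"
proof -
  \<comment> \<open>Closeness to 0 again forces the extreme entries; \<open>four_exact\<close> and
    \<open>three_two_exact\<close> then remove all stray ones.\<close>
  let ?u = "axis j 2 :: int ^ 'a"
  obtain V where V: "V \<in> T" "near V ?u" using T(1) unfolding tiling_def by blast
  obtain m where m: "\<And>l. l \<noteq> m \<Longrightarrow> ?u $ l - V $ l \<in> {-1, 0}" "?u $ m - V $ m \<in> {-2..1}"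
    using V(2) unfolding near_def by blast
  have out: "V $ l \<in> {0, 1}" if "l \<noteq> j" "l \<noteq> m" for l
    using m(1)[of l] that by (auto simp: axis_def)
  have Vj: "V $ j \<in> {1..4}" "j \<noteq> m \<Longrightarrow> V $ j \<in> {2, 3}"
    using m(1)[of j] m(2) by (auto simp: axis_def split: if_splits)
  have Vm: "m \<noteq> j \<Longrightarrow> V $ m \<in> {-1..2}"
    using m(2) by (auto simp: axis_def)
  have "V \<noteq> 0" using Vj by auto
  have A: "\<not> (\<bar>V $ a\<bar> \<le> 2 \<and> \<bar>V $ b\<bar> \<le> 2 \<and> (\<forall>l. l \<noteq> a \<longrightarrow> l \<noteq> b \<longrightarrow> \<bar>V $ l\<bar> \<le> 1))" for a b
    using tiling_eqI_two[OF T(1) V(1) T(2), of a b] \<open>V \<noteq> 0\<close> by auto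
  have B: "\<not> (\<bar>V $ a\<bar> \<le> 3 \<and> (\<forall>l. l \<noteq> a \<longrightarrow> \<bar>V $ l\<bar> \<le> 1))" for a
    using tiling_eqI_one[OF T(1) V(1) T(2), of a] \<open>V \<noteq> 0\<close> by auto
  have out1: "\<bar>V $ l\<bar> \<le> 1" if "l \<noteq> j" "l \<noteq> m" for l using out[OF that] by auto
  show thesis
  proof (cases "m = j")
    case True
    then have "V $ j = 4" using B[of j] out1 Vj by force
    then have "V = axis j 4" using four_exact[OF T V(1)] out True by auto
    then show thesis using that(1) V by simp
  next
    case False
    have m2: "V $ m = 2"
    proof (rule ccontr)
      assume "V $ m \<noteq> 2"
      then have "\<bar>V $ m\<bar> \<le> 1" using Vm False by auto
      then have "\<bar>V $ l\<bar> \<le> 1" if "l \<noteq> j" for l using out1[of l] that by (cases "l = m") auto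
      then show False using B[of j] Vj False by auto
    qed
    have "V $ j = 3" using A[of j m] Vj(2) m2 out1 False by force
    then have "V = axis j 3 + axis m 2"
      using three_two_exact[OF T V(1), of j m] m2 out False by auto
    then show thesis using that(2)[of m] V False by simp
  qed
qed

section \<open>Consequences of an edge tile\<close>

text \<open>With coordinate \<open>j\<close> reversed, the given tile becomes \<open>?Y\<close>. The
  tile that covers 2 e_i in these coordinates is 4 e_i or 3 e_i + 2 e_l, and all of these are too
  close to \<open>?Y\<close> except the one with \<open>l = j\<close>.\<close>

lemma edge_flip:
  assumes T: "tiling T" "0 \<in> T" and ij: "i \<noteq> j" and E: "axis i 3 + axis j 2 \<in> T"
  shows "axis i 3 + axis j (-2) \<in> T"
proof -
  define s :: "'a \<Rightarrow> int" where "s k = (if k = j then -1 else 1)" for k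
  have s: "s k \<in> {1, -1}" for k by (simp add: s_def)
  let ?T = "{x. flip s x \<in> T}"
  let ?Y = "axis i 3 + axis j (-2) :: int ^ 'a"
  have T': "tiling ?T" "0 \<in> ?T" using tiling_flip[of T s, OF T(1) s] T(2) by simp_all
  have "flip s ?Y = axis i 3 + axis j 2"
    using ij by (auto simp: flip_def vec_eq_iff axis_def s_def)
  then have Y: "?Y \<in> ?T" using E by simp
  from T' show ?thesis
  proof (cases rule: cover_double[where j = i])
    case 1
    then have "axis i 4 = ?Y"
      using tiling_eqI_two[OF T'(1) _ Y, of "axis i 4" j j] ij by (auto simp: axis_def)
    then show ?thesis using ij by (auto simp: vec_eq_iff axis_def dest: spec[of _ i])
  next
    case (2 l)
    have "l = j"
    proof (rule ccontr)
      assume "l \<noteq> j"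
      then have "axis i 3 + axis l 2 = ?Y"
        using tiling_eqI_two[OF T'(1) 2(2) Y, of l j] ij 2(1) by (auto simp: axis_def)
      then show False using ij \<open>l \<noteq> j\<close> by (auto simp: vec_eq_iff axis_def dest: spec[of _ j])
    qed
    moreover have "flip s (axis i 3 + axis j 2) = ?Y"
      using ij by (auto simp: flip_def vec_eq_iff axis_def s_def)
    ultimately show ?thesis using 2 by simp
  qed
qed

text \<open>Seen from the tile \<open>3 e\<^sub>i + 2 e\<^sub>j\<close>, the origin is an edge tile too; reversing the sign of its
  \<open>j\<close>-entry lands on \<open>4 e\<^sub>j\<close>.\<close>

lemma edge_imp_axis_four:
  assumes T: "tiling T" "0 \<in> T" and ij: "i \<noteq> j" and E: "axis i 3 + axis j 2 \<in> T"
  shows "axis j 4 \<in> T"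
proof -
  define s :: "'a \<Rightarrow> int" where "s k = (if k = i \<or> k = j then -1 else 1)" for k
  have s: "s k \<in> {1, -1}" for k by (simp add: s_def)
  let ?Y = "axis i 3 + axis j 2 :: int ^ 'a"
  let ?T = "{x. x + ?Y \<in> T}"
  let ?T' = "{x. flip s x \<in> ?T}"
  have T': "tiling ?T'" "0 \<in> ?T'"
    using tiling_flip[of _ s, OF tiling_translate[OF T(1)] s] E by simp_all
  have "flip s ?Y + ?Y = 0" using ij by (auto simp: flip_def vec_eq_iff axis_def s_def)
  then have "?Y \<in> ?T'" using T(2) by simp
  from edge_flip[OF T' ij this] have "flip s (axis i 3 + axis j (-2)) + ?Y \<in> T" by simp
  moreover have "flip s (axis i 3 + axis j (-2)) + ?Y = axis j 4"
    using ij by (auto simp: flip_def vec_eq_iff axis_def s_def)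
  ultimately show ?thesis by simp
qed

section \<open>Parity: existence of an edge tile\<close>

lemma even_card_involution:
  assumes "finite A" "\<And>x. x \<in> A \<Longrightarrow> f x \<in> A" "\<And>x. x \<in> A \<Longrightarrow> f (f x) = x" "\<And>x. x \<in> A \<Longrightarrow> f x \<noteq> x"
  shows "even (card A)"
proof -
  let ?C = "(\<lambda>x. {x, f x}) ` A"
  have U: "\<Union>?C = A" using assms(2) by auto
  have "2 * card ?C = card (\<Union>?C)"
  proof (rule card_partition)
    show "finite ?C" "finite (\<Union>?C)" using assms(1) U by auto
    show "card c = 2" if "c \<in> ?C" for c
    proof -
      from that obtain x where "x \<in> A" "c = {x, f x}" by blast
      then show ?thesis using assms(4)[of x] by simp
    qed
    show "c1 \<inter> c2 = {}" if "c1 \<in> ?C" "c2 \<in> ?C" "c1 \<noteq> c2" for c1 c2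
      using that assms(3) by (auto) (metis+)?
  qed
  then show ?thesis using U by (metis dvd_triv_left)
qed

lemma ex_edge:
  fixes T :: "(int ^ 'n) set"
  assumes T: "tiling T" "0 \<in> T" and ev: "even CARD('n)"
  shows "\<exists>i k. i \<noteq> k \<and> axis i 3 + axis k 2 \<in> T"
proof (rule ccontr)
  assume no: "\<not> ?thesis"
  \<comment> \<open>Any coordinate will do. Without edge tiles, \<open>tri\<close> turns out to
    match the remaining coordinates in pairs.\<close>
  fix i :: 'n
  define tri where "tri k m \<longleftrightarrow> k \<noteq> i \<and> m \<noteq> i \<and> k \<noteq> m \<and>
    (\<exists>V\<in>T. V $ i = 2 \<and> V $ k = 2 \<and> V $ m = 2 \<and> (\<forall>l. l \<notin> {i, k, m} \<longrightarrow> V $ l \<in> {0, 1}))" for k m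
  have ex: "\<exists>m. tri k m" if "k \<noteq> i" for k
  proof -
    from that have "i \<noteq> k" by simp
    from T this show ?thesis
    proof (cases rule: cover_two)
      case (1 V)
      then show ?thesis using three_two_exact[OF T 1(1), of i k] no \<open>i \<noteq> k\<close> by blast
    next
      case (2 V)
      then have "V = axis k 3 + axis i 2"
        using \<open>i \<noteq> k\<close> by (intro three_two_exact[OF T]) auto
      with 2(1) have "axis k 3 + axis i 2 \<in> T" by simp
      then show ?thesis using no that by blast
    next
      case (3 V m)
      then show ?thesis using that unfolding tri_def by (intro exI[of _ m]) blast
    qed
  qed
  have sym: "tri m k" if "tri k m" for k m
  proof -
    from that obtain V where "V \<in> T" "V $ i = 2" "V $ k = 2" "V $ m = 2"
      "\<forall>l. l \<notin> {i, k, m} \<longrightarrow> V $ l \<in> {0, 1}" "k \<noteq> i" "m \<noteq> i" "k \<noteq> m"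
      unfolding tri_def by blast
    then show ?thesis unfolding tri_def by (intro conjI bexI[of _ V]) blast+
  qed
  \<comment> \<open>Two triple tiles through \<open>i\<close> and \<open>k\<close> differ by 2 at
    most at \<open>m\<close> and \<open>m'\<close>, so \<open>tiling_eqI_two\<close> identifies
    them.\<close>
  have uniq: "m = m'" if tri: "tri k m" "tri k m'" for k m m'
  proof (rule ccontr)
    assume ne: "m \<noteq> m'"
    obtain V where V: "V \<in> T" "V $ i = 2" "V $ k = 2" "V $ m = 2"
      "\<And>l. l \<noteq> i \<Longrightarrow> l \<noteq> k \<Longrightarrow> l \<noteq> m \<Longrightarrow> V $ l \<in> {0, 1}" using tri(1) unfolding tri_def by auto
    obtain W where W: "W \<in> T" "W $ i = 2" "W $ k = 2" "W $ m' = 2"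
      "\<And>l. l \<noteq> i \<Longrightarrow> l \<noteq> k \<Longrightarrow> l \<noteq> m' \<Longrightarrow> W $ l \<in> {0, 1}" using tri(2) unfolding tri_def by auto
    have d: "k \<noteq> i" "m \<noteq> i" "k \<noteq> m" "m' \<noteq> i" "k \<noteq> m'" using tri unfolding tri_def by auto
    have "\<bar>V $ l - W $ l\<bar> \<le> 1" if "l \<noteq> m" "l \<noteq> m'" for l
      using V(2,3) V(5)[of l] W(2,3) W(5)[of l] that by (cases "l = i"; cases "l = k") auto
    then have "V = W"
      using tiling_eqI_two[OF T(1) V(1) W(1), of m m'] V(4) W(4) V(5)[of m'] W(5)[of m] d ne by auto
    then show False using V(4) W(5)[of m] d ne by auto
  qed
  define f where "f k = (SOME m. tri k m)" for k
  have f: "tri k (f k)" if "k \<noteq> i" for k using ex[OF that] unfolding f_def by (rule someI_ex)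
  have "even (card (UNIV - {i}))"
  proof (rule even_card_involution[of _ f])
    fix k assume "k \<in> UNIV - {i}"
    then have k: "tri k (f k)" using f by blast
    then show fk: "f k \<in> UNIV - {i}" "f k \<noteq> k" unfolding tri_def by auto
    show "f (f k) = k" using uniq[OF sym[OF k] f[of "f k"]] fk by auto
  qed auto
  moreover have "card (UNIV - {i}) = CARD('n) - 1" by simp
  \<comment> \<open>Subtraction is truncated: for 0 the predecessor would be even as well.\<close>
  moreover have "CARD('n) \<noteq> 0" by simp
  ultimately show False using ev by simp
qed

section \<open>Neighbour sums modulo 3\<close>

text \<open>The Frobenius identity for a symmetric summand. Inserting \<open>d\<close> adds the
  triples with one or two entries equal to \<open>d\<close>; by symmetry these come in three equal
  groups, so only \<open>h d d d\<close> survives modulo 3.\<close>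

lemma sum_cube_cong_diag:
  fixes h :: "'a \<Rightarrow> 'a \<Rightarrow> 'a \<Rightarrow> int"
  assumes "finite A" and h1: "\<And>a b c. h a b c = h b a c" and h2: "\<And>a b c. h a b c = h a c b"
  shows "[(\<Sum>a\<in>A. \<Sum>b\<in>A. \<Sum>c\<in>A. h a b c) = (\<Sum>a\<in>A. h a a a)] (mod 3)"
  using assms(1)
proof (induction A rule: finite_induct)
  case (insert d A)
  let ?P = "(\<Sum>a\<in>A. \<Sum>b\<in>A. \<Sum>c\<in>A. h a b c)" and ?Q = "\<Sum>b\<in>A. \<Sum>c\<in>A. h d b c" and ?R = "\<Sum>c\<in>A. h d d c"
  have e: "(\<Sum>a\<in>A. \<Sum>c\<in>A. h a d c) = ?Q" "(\<Sum>a\<in>A. \<Sum>c\<in>A. h a c d) = ?Q"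
      "(\<Sum>a\<in>A. h a d d) = ?R" "(\<Sum>a\<in>A. h d a d) = ?R"
    by (intro sum.cong refl; metis h1 h2)+
  have l: "(\<Sum>a\<in>insert d A. \<Sum>b\<in>insert d A. \<Sum>c\<in>insert d A. h a b c) = ?P + 3 * ?Q + 3 * ?R + h d d d"
    using insert(1,2) by (simp add: sum.distrib e)
  have r: "(\<Sum>a\<in>insert d A. h a a a) = (\<Sum>a\<in>A. h a a a) + h d d d"
    using insert(1,2) by simp
  have "[?P + 3 * ?Q + 3 * ?R + h d d d = ?P + h d d d] (mod 3)"
    by (simp add: cong_iff_dvd_diff)
  also have "[?P + h d d d = (\<Sum>a\<in>A. h a a a) + h d d d] (mod 3)"
    by (intro cong_add insert.IH cong_refl)
  finally show ?case unfolding l r .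
qed auto

text \<open>Only the tile \<open>x\<close> covering \<open>u\<close> matters. If \<open>u\<close>
  lies in its cube, exactly one of the two neighbours in each direction stays inside, giving n,
  which is 1 modulo 3. Otherwise only the step back along \<open>l\<close> enters the cube, giving
  1.\<close>

lemma neighbour_sum_cong:
  fixes T :: "(int ^ 'n) set" and u :: "int ^ 'n"
  assumes T: "tiling T" and n: "[int CARD('n) = 1] (mod 3)"
  shows "[(\<Sum>(i, s)\<in>UNIV \<times> {1, -1}. of_bool (u + axis i s \<in> cubes T)) = (1::int)] (mod 3)"
proof -
  obtain x where x: "x \<in> T" "near x u" "\<And>y. y \<in> T \<Longrightarrow> near y u \<Longrightarrow> y = x"
    using T unfolding tiling_def by metis
  obtain l where l: "\<And>i. i \<noteq> l \<Longrightarrow> u $ i - x $ i \<in> {-1, 0}" "u $ l - x $ l \<in> {-2..1}"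
    using x(2) unfolding near_def by blast
  \<comment> \<open>A tile whose cube contains a neighbour of \<open>u\<close> covers
    \<open>u\<close> itself, hence is \<open>x\<close>.\<close>
  have mem: "u + axis i s \<in> cubes T \<longleftrightarrow> (\<forall>k. (u + axis i s) $ k - x $ k \<in> {-1, 0})"
    if "s \<in> {1, -1}" for i s
  proof
    assume "u + axis i s \<in> cubes T"
    then obtain y where y: "y \<in> T" "\<And>k. (u + axis i s) $ k - y $ k \<in> {-1, 0}"
      unfolding cubes_def by blast
    have "u $ k - y $ k \<in> {-1, 0}" if "k \<noteq> i" for k using y(2)[of k] that by (auto simp: axis_def)
    moreover have "u $ i - y $ i \<in> {-2..1}" using y(2)[of i] that by (auto simp: axis_def)
    ultimately have "near y u" unfolding near_def by blast
    then show "\<forall>k. (u + axis i s) $ k - x $ k \<in> {-1, 0}" using x(3) y by blast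
  next
    assume "\<forall>k. (u + axis i s) $ k - x $ k \<in> {-1, 0}"
    then show "u + axis i s \<in> cubes T" using x(1) unfolding cubes_def by blast
  qed
  have "(\<Sum>(i, s)\<in>UNIV \<times> {1, -1}. of_bool (u + axis i s \<in> cubes T)) =
      (\<Sum>i\<in>UNIV. \<Sum>s\<in>{1, -1}. of_bool (u + axis i s \<in> cubes T) :: int)"
    by (rule sum.cartesian_product[symmetric])
  also have "\<dots> = (\<Sum>i\<in>UNIV. of_bool (u + axis i 1 \<in> cubes T) + of_bool (u + axis i (-1) \<in> cubes T))"
    by (intro sum.cong refl) (subst sum.insert; force)
  finally have eq: "(\<Sum>(i, s)\<in>UNIV \<times> {1, -1}. of_bool (u + axis i s \<in> cubes T)) =
      (\<Sum>i\<in>UNIV. of_bool (u + axis i 1 \<in> cubes T) + of_bool (u + axis i (-1) \<in> cubes T) :: int)" .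
  show ?thesis
  proof (cases "u $ l - x $ l \<in> {-1, 0}")
    case True
    then have c: "u $ k - x $ k \<in> {-1, 0}" for k using l(1)[of k] by (cases "k = l") auto
    have m: "u + axis i s \<in> cubes T \<longleftrightarrow> u $ i + s - x $ i \<in> {-1, 0}" if "s \<in> {1, -1}" for i s
      unfolding mem[OF that] using c by (force simp: axis_def)
    have "of_bool (u + axis i 1 \<in> cubes T) + of_bool (u + axis i (-1) \<in> cubes T) = (1::int)" for i
      using c[of i] by (auto simp: m)
    then show ?thesis using n unfolding eq by simp
  next
    case False
    have "u + axis i s \<notin> cubes T" if "s \<in> {1, -1}" "i \<noteq> l" for i s
      unfolding mem[OF that(1)] using False that(2) by (auto simp: axis_def intro!: exI[of _ l])
    moreover have "u + axis l s \<in> cubes T \<longleftrightarrow> u $ l + s - x $ l \<in> {-1, 0}" if "s \<in> {1, -1}" for s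
      unfolding mem[OF that] using l(1) by (force simp: axis_def)
    ultimately have "of_bool (u + axis i 1 \<in> cubes T) + of_bool (u + axis i (-1) \<in> cubes T)
        = (if i = l then 1 else 0::int)" for i
      using False l(2) by (cases "i = l") auto
    then show ?thesis unfolding eq by simp
  qed
qed

text \<open>The sum of \<open>f\<close> over the endpoints of all three-step walks from
  \<open>u\<close> is evaluated twice: through neighbour sums it is 4 modulo 3, and by symmetry it
  reduces to the walks repeating one step three times. So the latter sum is nonzero.\<close>

lemma ex_step_three:
  fixes T :: "(int ^ 'n) set" and u :: "int ^ 'n"
  assumes T: "tiling T" and n: "[int CARD('n) = 1] (mod 3)"
  shows "\<exists>i. \<exists>s\<in>{3, -3}. u + axis i s \<in> cubes T"
proof -
  let ?A = "UNIV \<times> {1, -1} :: ('n \<times> int) set"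
  define \<delta> :: "'n \<times> int \<Rightarrow> int ^ 'n" where "\<delta> p = axis (fst p) (snd p)" for p
  define f :: "int ^ 'n \<Rightarrow> int" where "f v = of_bool (v \<in> cubes T)" for v
  have N: "[(\<Sum>p\<in>?A. f (v + \<delta> p)) = 1] (mod 3)" for v
    using neighbour_sum_cong[OF T n, of v] by (simp add: f_def \<delta>_def case_prod_unfold)
  have cA: "int (card ?A) = 2 * int CARD('n)" by (simp add: card_cartesian_product)
  have "[(\<Sum>a\<in>?A. \<Sum>b\<in>?A. \<Sum>c\<in>?A. f (u + \<delta> a + \<delta> b + \<delta> c)) = (\<Sum>a\<in>?A. \<Sum>b\<in>?A. 1)] (mod 3)"
    \<comment> \<open>Only the innermost sum is replaced by 1; the outer two then count pairs of
      steps.\<close>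
    by (intro cong_sum N)
  also have "(\<Sum>a\<in>?A. \<Sum>b\<in>?A. 1::int) = (2 * int CARD('n)) * (2 * int CARD('n))" using cA by simp
  also have "[\<dots> = (2 * 1) * (2 * 1)] (mod 3)" by (intro cong_mult n cong_refl)
  finally have "[(\<Sum>a\<in>?A. \<Sum>b\<in>?A. \<Sum>c\<in>?A. f (u + \<delta> a + \<delta> b + \<delta> c)) = 4] (mod 3)" by simp
  moreover have "[(\<Sum>a\<in>?A. \<Sum>b\<in>?A. \<Sum>c\<in>?A. f (u + \<delta> a + \<delta> b + \<delta> c))
      = (\<Sum>a\<in>?A. f (u + \<delta> a + \<delta> a + \<delta> a))] (mod 3)"
    by (rule sum_cube_cong_diag) (auto simp: ac_simps)
  ultimately have "[(\<Sum>a\<in>?A. f (u + \<delta> a + \<delta> a + \<delta> a)) = 4] (mod 3)"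
    using cong_sym cong_trans by blast
  then have "(\<Sum>a\<in>?A. f (u + \<delta> a + \<delta> a + \<delta> a)) \<noteq> 0" by (auto simp: cong_def)
  then obtain a where a: "a \<in> ?A" "f (u + \<delta> a + \<delta> a + \<delta> a) \<noteq> 0" by (meson sum.neutral)
  have "u + \<delta> a + \<delta> a + \<delta> a = u + axis (fst a) (3 * snd a)"
    by (auto simp: vec_eq_iff axis_def \<delta>_def)
  moreover have "u + \<delta> a + \<delta> a + \<delta> a \<in> cubes T" using a(2) unfolding f_def by (metis of_bool_eq(1))
  ultimately have "u + axis (fst a) (3 * snd a) \<in> cubes T" by metis
  with a(1) show ?thesis by (intro exI[of _ "fst a"] bexI[of _ "3 * snd a"]) auto
qed

section \<open>The contradiction at e_i\<close>

text \<open>A tile \<open>y\<close> whose cube contains the point is mostly too close to a known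
  tile. What remains is an edge with entry 2 at \<open>i\<close>, up to a reflection; by
  \<open>edge_imp_axis_four\<close> it forces 4 e_i, which is too close to the given edge with entry
  3 at \<open>i\<close>.\<close>

lemma no_step_three:
  assumes T: "tiling T" "0 \<in> T" and ik: "i \<noteq> k" and E: "axis i 3 + axis k 2 \<in> T"
    and s: "s \<in> {3, -3}"
  shows "axis i 1 + axis j s \<notin> cubes T"
proof
  assume "axis i 1 + axis j s \<in> cubes T"
  then obtain y where y: "y \<in> T" "\<And>l. (axis i 1 + axis j s) $ l - y $ l \<in> {-1, 0}"
    unfolding cubes_def by blast
  have out: "y $ l \<in> {0, 1}" if "l \<noteq> i" "l \<noteq> j" for l using y(2)[of l] that by (auto simp: axis_def)
  have no4: "axis i 4 \<notin> T"
  proof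
    assume "axis i 4 \<in> T"
    then have "axis i 4 = (axis i 3 + axis k 2 :: int ^ 'a)"
      using tiling_eqI_two[OF T(1) _ E, of "axis i 4" k k] ik by (auto simp: axis_def)
    then show False using ik by (auto simp: vec_eq_iff axis_def dest: spec[of _ k])
  qed
  consider "j = i" "s = 3" | "j = i" "s = -3" | "j \<noteq> i" "s = 3" | "j \<noteq> i" "s = -3" using s by auto
  then show False
  proof cases
    case 1
    have yi: "y $ i \<in> {4, 5}" using y(2)[of i] 1 by (auto simp: axis_def)
    have "\<bar>y $ l - (axis i 3 + axis k 2) $ l\<bar> \<le> 1" if "l \<noteq> i" "l \<noteq> k" for l
      using out[of l] that 1 by (auto simp: axis_def)
    moreover have "\<bar>y $ k - (axis i 3 + axis k 2) $ k\<bar> \<le> 2" using out[of k] ik 1 by (auto simp: axis_def)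
    moreover have "\<bar>y $ i - (axis i 3 + axis k 2) $ i\<bar> \<le> 2" using yi ik by (auto simp: axis_def)
    ultimately have "y = axis i 3 + axis k 2" using tiling_eqI_two[OF T(1) y(1) E, of i k] by auto
    then show False using yi ik by (auto simp: axis_def)
  next
    case 2
    have yi: "y $ i \<in> {-2, -1}" using y(2)[of i] 2 by (auto simp: axis_def)
    have "\<bar>y $ l\<bar> \<le> 1" if "l \<noteq> i" for l using out[of l] that 2 by auto
    then have "y = 0" using tiling_eqI_two[OF T(1) y(1) T(2), of i i] yi by auto
    then show False using yi by auto
  next
    case 3
    have yi: "y $ i \<in> {1, 2}" using y(2)[of i] 3 by (auto simp: axis_def)
    have yj: "y $ j \<in> {3, 4}" using y(2)[of j] 3 by (auto simp: axis_def)
    have not4: "y $ j \<noteq> 4"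
    proof
      assume j4: "y $ j = 4"
      have "y $ i \<noteq> 1"
      proof
        assume "y $ i = 1"
        then have "y $ l \<in> {0, 1}" if "l \<noteq> j" for l using out[of l] that by (cases "l = i") auto
        then have "y = axis j 4" by (rule four_exact[OF T y(1) j4])
        then show False using \<open>y $ i = 1\<close> 3 by (auto simp: axis_def)
      qed
      then have i2: "y $ i = 2" using yi by auto
      \<comment> \<open>Either tile that can cover 2 e_j is close enough to equal \<open>y\<close>,
        but 4 e_j lacks the entry 2 at \<open>i\<close>, and the other has 3 instead of 4 at
        \<open>j\<close>.\<close>
      from T show False
      proof (cases rule: cover_double[where j = j])
        case 1
        have "\<bar>axis j 4 $ l - y $ l\<bar> \<le> 1" if "l \<noteq> i" for l
          using out[of l] that j4 by (auto simp: axis_def)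
        then have "axis j 4 = y" using tiling_eqI_two[OF T(1) 1 y(1), of i i] i2 3 by (auto simp: axis_def)
        then show False using i2 3 by (auto simp: axis_def)
      next
        case (2 l)
        let ?V = "axis j 3 + axis l 2 :: int ^ 'a"
        have "\<bar>?V $ m - y $ m\<bar> \<le> 1" if "m \<noteq> i" "m \<noteq> l" for m
          using out[of m] that j4 2 by (auto simp: axis_def)
        moreover have "\<bar>?V $ i - y $ i\<bar> \<le> 2" using i2 3 by (auto simp: axis_def)
        moreover have "\<bar>?V $ l - y $ l\<bar> \<le> 2" using i2 2 out[of l] by (cases "l = i") (auto simp: axis_def)
        ultimately have "?V = y" using tiling_eqI_two[OF T(1) 2(2) y(1), of i l] by blast
        then have "?V $ j = y $ j" by simp
        then show False using j4 2 by (auto simp: axis_def)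
      qed
    qed
    then have j3: "y $ j = 3" using yj by auto
    have "y $ i \<noteq> 1"
    proof
      assume "y $ i = 1"
      then have "\<bar>y $ l\<bar> \<le> 1" if "l \<noteq> j" for l using out[of l] that by (cases "l = i") auto
      then have "y = 0" using tiling_eqI_one[OF T(1) y(1) T(2), of j] j3 by auto
      then show False using j3 by auto
    qed
    then have i2: "y $ i = 2" using yi by auto
    have "y = axis j 3 + axis i 2" using three_two_exact[OF T y(1) 3(1) j3 i2] out by auto
    then have "axis i 4 \<in> T" using edge_imp_axis_four[OF T 3(1)] y(1) by simp
    with no4 show False ..
  next
    case 4
    have yi: "y $ i \<in> {1, 2}" using y(2)[of i] 4 by (auto simp: axis_def)
    \<comment> \<open>Not the mirror image of the values 3 and 4 above, since the cube is not
      centred at 0.\<close>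
    have yj: "y $ j \<in> {-3, -2}" using y(2)[of j] 4 by (auto simp: axis_def)
    have out1: "\<bar>y $ l\<bar> \<le> 1" if "l \<noteq> i" "l \<noteq> j" for l using out[OF that] by auto
    have y0: "y \<noteq> 0" using yi by auto
    have "y $ i \<noteq> 1"
    proof
      assume "y $ i = 1"
      then have "\<bar>y $ l\<bar> \<le> 1" if "l \<noteq> j" for l using out1[of l] that by (cases "l = i") auto
      then show False using tiling_eqI_one[OF T(1) y(1) T(2), of j] yj y0 by auto
    qed
    then have i2: "y $ i = 2" using yi by auto
    have "y $ j \<noteq> -2" using tiling_eqI_two[OF T(1) y(1) T(2), of i j] i2 out1 y0 by auto
    then have j3: "y $ j = -3" using yj by auto
    \<comment> \<open>Reversing \<open>j\<close> turns \<open>y\<close> into an edge tile and fixes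
      4 e_i.\<close>
    define r :: "'a \<Rightarrow> int" where "r l = (if l = j then -1 else 1)" for l
    have r: "r l \<in> {1, -1}" for l by (simp add: r_def)
    let ?T = "{x. flip r x \<in> T}"
    have T': "tiling ?T" "0 \<in> ?T" using tiling_flip[of T r, OF T(1) r] T(2) by simp_all
    have fy: "flip r y \<in> ?T" using y(1) by (simp add: flip_flip[of r, OF r])
    have "flip r y = axis j 3 + axis i 2"
      using i2 j3 4 out by (intro three_two_exact[OF T' fy]) (auto simp: flip_def r_def)
    then have "flip r (axis i 4) \<in> T" using edge_imp_axis_four[OF T' 4(1)] fy by simp
    moreover have "flip r (axis i 4) = axis i 4"
      using 4 by (auto simp: flip_def vec_eq_iff axis_def r_def)
    ultimately show False using no4 by simp
  qed
qed

theorem theorem4: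
  fixes T :: "(int ^ 'n) set"
  assumes "integer_tiling T Upsilon"
  shows "\<not> [CARD('n) = 4] (mod 6)"
proof
  assume n: "[CARD('n) = 4] (mod 6)"
  then have "CARD('n) mod 6 = 4" by (simp add: cong_def)
  then have "even CARD('n)" "CARD('n) mod 3 = 1" by presburger+
  then have "[CARD('n) = 1] (mod 3)" by (simp add: cong_def)
  then have n3: "[int CARD('n) = 1] (mod 3)" using cong_int_iff[of "CARD('n)" 1 3] by simp
  have T: "tiling T" using assms by (rule integer_tiling_Upsilon_imp_tiling)
  then obtain c where "c \<in> T" unfolding tiling_def by blast
  then have T0: "tiling {x. x + c \<in> T}" "0 \<in> {x. x + c \<in> T}" using tiling_translate[OF T] by auto
  obtain i k :: 'n where ik: "i \<noteq> k" "axis i 3 + axis k 2 \<in> {x. x + c \<in> T}"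
    using ex_edge[OF T0 \<open>even CARD('n)\<close>] by blast
  from ex_step_three[OF T0(1) n3, of "axis i 1"] no_step_three[OF T0 ik] show False by blast
qed

end
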